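(* If $G$ is an isolate-free graph with minimum degree $\delta(G) = 1$ that does not contain a universal vertex, then $c_{\min}(G)=2$.
   Context: Graphs are finite, simple and undirected, with nonempty vertex set. A graph is isolate-free if it has no vertex of degree $0$. A vertex $v$ is universal if it is adjacent to all other vertices of $G$. A set $S\subseteq V(G)$ is a dominating set of $G$ if every vertex of $V(G)\setminus S$ is adjacent to a vertex of $S$. All parts of a partition are nonempty. Two disjoint sets $X,Y\subseteq V(G)$ form a coalition in $G$ if neither $X$ nor $Y$ is a dominating set of $G$ but $X\cup Y$ is a dominating set of $G$. A $c$-partition of $G$ is a partition $\{V_1,\ldots,V_k\}$ of $V(G)$ such that each $V_i$ either is a dominating set consisting of a single vertex, or forms a coalition with some other set $V_j$ ($j\neq i$) of the partition. For partitions $\mathcal{A},\mathcal{B}$ of $V(G)$, $\mathcal{B}$ is a refinement of $\mathcal{A}$ if every set of $\mathcal{B}$ is equal to or a proper subset of some set of $\mathcal{A}$; it is a proper refinement if moreover $\mathcal{A}\ne\mathcal{B}$. A $c$-partition is minimal if it is not a proper refinement of any other $c$-partition of $G$. The minmin coalition number $c_{\min}(G)$ is the minimum number of sets in a minimal $c$-partition of $G$. *)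

theory Defs
  imports Main "HOL-Library.Disjoint_Sets"
begin

locale simple_graph =
  fixes V :: "'a set" and E :: "'a set set"
  assumes finite_verts: "finite V"
    and verts_nonempty: "V \<noteq> {}"
    and edges: "\<And>e. e \<in> E \<Longrightarrow> e \<subseteq> V \<and> card e = 2"

definition adjacent :: "'a set set \<Rightarrow> 'a \<Rightarrow> 'a \<Rightarrow> bool" where
  "adjacent E u v \<longleftrightarrow> {u, v} \<in> E"

definition degree :: "'a set \<Rightarrow> 'a set set \<Rightarrow> 'a \<Rightarrow> nat" where
  "degree V E v = card {u \<in> V. adjacent E v u}"

definition min_degree :: "'a set \<Rightarrow> 'a set set \<Rightarrow> nat" where
  "min_degree V E = Min (degree V E ` V)"

definition isolate_free :: "'a set \<Rightarrow> 'a set set \<Rightarrow> bool" where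
  "isolate_free V E \<longleftrightarrow> (\<forall>v\<in>V. degree V E v \<noteq> 0)"

definition universal :: "'a set \<Rightarrow> 'a set set \<Rightarrow> 'a \<Rightarrow> bool" where
  "universal V E v \<longleftrightarrow> v \<in> V \<and> (\<forall>u\<in>V - {v}. adjacent E v u)"

definition dominating :: "'a set \<Rightarrow> 'a set set \<Rightarrow> 'a set \<Rightarrow> bool" where
  "dominating V E S \<longleftrightarrow> S \<subseteq> V \<and> (\<forall>v\<in>V - S. \<exists>u\<in>S. adjacent E v u)"

definition coalition :: "'a set \<Rightarrow> 'a set set \<Rightarrow> 'a set \<Rightarrow> 'a set \<Rightarrow> bool" where
  "coalition V E X Y \<longleftrightarrow> X \<subseteq> V \<and> Y \<subseteq> V \<and> X \<inter> Y = {} \<and>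
     \<not> dominating V E X \<and> \<not> dominating V E Y \<and> dominating V E (X \<union> Y)"

definition c_partition :: "'a set \<Rightarrow> 'a set set \<Rightarrow> 'a set set \<Rightarrow> bool" where
  "c_partition V E P \<longleftrightarrow> partition_on V P \<and>
     (\<forall>X\<in>P. (dominating V E X \<and> (\<exists>v. X = {v})) \<or> (\<exists>Y\<in>P - {X}. coalition V E X Y))"

definition proper_refinement :: "'a set \<Rightarrow> 'a set set \<Rightarrow> 'a set set \<Rightarrow> bool" where
  "proper_refinement V B A \<longleftrightarrow> refines V B A \<and> B \<noteq> A"

definition minimal_c_partition :: "'a set \<Rightarrow> 'a set set \<Rightarrow> 'a set set \<Rightarrow> bool" where
  "minimal_c_partition V E P \<longleftrightarrow> c_partition V E P \<and>
     \<not> (\<exists>A. c_partition V E A \<and> proper_refinement V P A)"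

(* The set below is finite because V is; it is nonempty because every graph has a c-partition.
   Min of the empty set is unspecified, so no value of c_min can be established without
   exhibiting a minimal c-partition. *)
definition c_min :: "'a set \<Rightarrow> 'a set set \<Rightarrow> nat" where
  "c_min V E = Min (card ` {P. minimal_c_partition V E P})"

end

theory Submission
  imports Defs
begin

text \<open>
  Without a universal vertex, the whole vertex set is never a part of a \<open>c\<close>-partition: it is
  dominating, so it forms no coalition, and it is no singleton, because the vertex of a one-vertex
  graph is universal. Hence every \<open>c\<close>-partition has at least two parts, and one with exactly two
  parts is minimal, because the trivial partition is its only proper coarsening.

  It remains to split the vertices into two non-dominating sets; these form a coalition, since
  their union is everything. A set and its complement are both non-dominating exactly if each of
  them contains the closed neighbourhood of some vertex. A leaf \<open>x\<close> has closed neighbourhood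
  \<open>{x, y}\<close>, where \<open>y\<close> is its neighbour. Since \<open>y\<close> is not universal, some vertex \<open>v\<close> lies outside
  the closed neighbourhood of \<open>y\<close>. This vertex is not \<open>x\<close> and, \<open>x\<close> being a leaf, not adjacent to
  \<open>x\<close> either, so the closed neighbourhood of \<open>v\<close> avoids \<open>{x, y}\<close>. The split into \<open>{x, y}\<close> and its
  complement is therefore a minimal \<open>c\<close>-partition.
\<close>

lemma adjacent_commute: "adjacent E u v \<longleftrightarrow> adjacent E v u"
  by (simp add: adjacent_def insert_commute)

lemma dominating_whole: "dominating V E V"
  by (simp add: dominating_def)

lemma whole_notin_c_partition:
  assumes "\<not> (\<exists>v. universal V E v)" and "c_partition V E P"
  shows "V \<notin> P"
proof
  assume "V \<in> P"
  moreover have "\<not> coalition V E V Y" for Y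
    by (simp add: coalition_def dominating_whole)
  ultimately obtain v where "V = {v}"
    using assms(2) unfolding c_partition_def by blast
  then have "universal V E v"
    by (simp add: universal_def)
  then show False
    using assms(1) by blast
qed

lemma two_le_card_c_partition:
  assumes "finite V" and "V \<noteq> {}" and "\<not> (\<exists>v. universal V E v)" and "c_partition V E P"
  shows "2 \<le> card P"
proof (rule ccontr)
  assume "\<not> 2 \<le> card P"
  have part: "partition_on V P"
    using assms(4) by (simp add: c_partition_def)
  then have "finite P"
    using assms(1) finite_elements by blast
  moreover have "P \<noteq> {}"
    using part assms(2) by (auto dest: partition_onD1)
  ultimately have "card P = 1"
    using \<open>\<not> 2 \<le> card P\<close> card_gt_0_iff[of P] by linarith
  then obtain X where "P = {X}"
    by (rule card_1_singletonE)
  then have "V \<in> P"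
    using part by (auto dest: partition_onD1)
  then show False
    using whole_notin_c_partition assms(3,4) by blast
qed

lemma minimal_c_partition_two_parts:
  assumes no_universal: "\<not> (\<exists>v. universal V E v)"
    and P: "c_partition V E {A, B}"
  shows "minimal_c_partition V E {A, B}"
proof -
  have "Q = {A, B}" if Q: "c_partition V E Q" and ref: "refines V {A, B} Q" for Q
  proof -
    have part: "partition_on V Q" "partition_on V {A, B}"
      using P Q by (simp_all add: c_partition_def)
    have V: "V = A \<union> B"
      using partition_onD1[OF part(2)] by simp
    obtain Y Z where YZ: "Y \<in> Q" "A \<subseteq> Y" "Z \<in> Q" "B \<subseteq> Z"
      using ref unfolding refines_def by auto
    have sub: "X \<subseteq> V" if "X \<in> Q" for X
      using that partition_onD1[OF part(1)] by blast
    have "Y \<noteq> Z"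
    proof
      assume "Y = Z"
      then have "Y = V"
        using YZ V sub by blast
      then show False
        using YZ(1) whole_notin_c_partition[OF no_universal Q] by blast
    qed
    have disj: "X \<inter> X' = {}" if "X \<in> Q" "X' \<in> Q" "X \<noteq> X'" for X X'
      using partition_onD2[OF part(1)] that by (auto dest: disjointD)
    have "Y = A" "Z = B"
      using disj[OF YZ(1,3) \<open>Y \<noteq> Z\<close>] sub[OF YZ(1)] sub[OF YZ(3)] YZ V by blast+
    moreover have "X \<in> {Y, Z}" if "X \<in> Q" for X
    proof (rule ccontr)
      \<comment> \<open>A third part would be disjoint from \<open>A\<close> and \<open>B\<close>, hence empty.\<close>
      assume "X \<notin> {Y, Z}"
      then have "X \<inter> Y = {}" "X \<inter> Z = {}"
        using disj that YZ by auto
      then have "X = {}"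
        using sub[OF that] V YZ by blast
      then show False
        using that partition_onD3[OF part(1)] by blast
    qed
    ultimately show ?thesis
      using YZ by blast
  qed
  then show ?thesis
    using P by (auto simp: minimal_c_partition_def proper_refinement_def)
qed

text \<open>
  The set \<open>A\<close> contains the closed neighbourhood of \<open>u\<close>, its complement that of \<open>v\<close>. So \<open>A\<close> fails to dominate \<open>v\<close>, and its complement fails to dominate \<open>u\<close>.
\<close>

lemma c_partition_split:
  assumes "A \<subseteq> V"
    and "u \<in> A" "\<And>w. w \<in> V - A \<Longrightarrow> \<not> adjacent E u w"
    and "v \<in> V - A" "\<And>w. w \<in> A \<Longrightarrow> \<not> adjacent E v w"
  shows "c_partition V E {A, V - A}"
proof -
  have "\<not> dominating V E A"
    using assms(4,5) by (auto simp: dominating_def)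
  moreover have "\<not> dominating V E (V - A)"
    using assms(1-3) by (auto simp: dominating_def)
  moreover have "A \<union> (V - A) = V"
    using assms(1) by blast
  ultimately have "coalition V E A (V - A)" "coalition V E (V - A) A"
    using assms(1) by (auto simp: coalition_def dominating_whole Un_commute)
  moreover have "A \<noteq> V - A"
    using assms(2) by blast
  moreover have "partition_on V {A, V - A}"
    using assms(1,2,4) by (auto simp: partition_on_def disjoint_def)
  ultimately show ?thesis
    by (auto simp: c_partition_def)
qed

lemma c_min_eq_2:
  assumes "finite V" and "V \<noteq> {}" and "\<not> (\<exists>v. universal V E v)"
    and "c_partition V E {A, B}" and "A \<noteq> B"
  shows "c_min V E = 2"
  unfolding c_min_def
proof (rule Min_eqI)
  have "{P. minimal_c_partition V E P} \<subseteq> {P. partition_on V P}"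
    by (auto simp: minimal_c_partition_def c_partition_def)
  then show "finite (card ` {P. minimal_c_partition V E P})"
    using finitely_many_partition_on[OF assms(1)] by (auto intro: finite_subset)
  show "2 \<le> k" if "k \<in> card ` {P. minimal_c_partition V E P}" for k
    using that two_le_card_c_partition[OF assms(1-3)] by (auto simp: minimal_c_partition_def)
  have "card {A, B} = 2"
    using assms(5) by simp
  then show "2 \<in> card ` {P. minimal_c_partition V E P}"
    using minimal_c_partition_two_parts[OF assms(3,4)] by force
qed

theorem lemma1:
  fixes V :: "'a set" and E :: "'a set set"
  assumes "simple_graph V E"
    and "isolate_free V E"
    and "min_degree V E = 1"
    and "\<not> (\<exists>v. universal V E v)"
  shows "c_min V E = 2"
proof -
  interpret simple_graph V E
    by (fact assms(1))
  have "1 \<in> degree V E ` V"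
    using Min_in[of "degree V E ` V"] finite_verts verts_nonempty assms(3)
    unfolding min_degree_def by (metis finite_imageI image_is_empty)
  then obtain x where x: "x \<in> V" "card {u \<in> V. adjacent E x u} = 1"
    by (auto simp: degree_def)
  then obtain y where nbrs: "{u \<in> V. adjacent E x u} = {y}"
    by (meson card_1_singletonE)
  then have y: "y \<in> V" "adjacent E x y"
    by auto
  have leaf: "w = y" if "w \<in> V" "adjacent E x w" for w
    using nbrs that by auto
  obtain v where v: "v \<in> V" "v \<noteq> y" "\<not> adjacent E y v"
    using assms(4) y(1) by (auto simp: universal_def)
  have "v \<noteq> x"
    using v(3) y(2) adjacent_commute by metis
  have "c_partition V E {{x, y}, V - {x, y}}"
  proof (rule c_partition_split)
    show "\<not> adjacent E x w" if "w \<in> V - {x, y}" for w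
      using leaf that by blast
    show "\<not> adjacent E v w" if "w \<in> {x, y}" for w
      using that leaf v adjacent_commute by (metis insertE singletonD)
  qed (use x(1) y(1) v \<open>v \<noteq> x\<close> in auto)
  moreover have "{x, y} \<noteq> V - {x, y}"
    by blast
  ultimately show ?thesis
    using c_min_eq_2[OF finite_verts verts_nonempty assms(4)] by blast
qed

end
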